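(* Let $G=(V,E)$ be a finite directed graph with nodes $v_1,\dots,v_n$, let $c\in(0,1)$ be the decay factor, let $S$ be the SimRank matrix of $G$, and let $\varepsilon\in(0,1)$. For each source node $v_i$ let $\vec{s}^{L}$ be the (random) vector output by the basic ExactSim algorithm on input $(G,v_i,\varepsilon)$. Then, with probability at least $1-1/n$, for every source node $v_i\in V$ the vector $\vec{s}^{L}$ produced for the source $v_i$ satisfies, for every node $v_j\in V$, $$\left|\vec{s}^{L}(j)-S(i,j)\right|\le \varepsilon .$$
   Context: For a node $v$, $\mathcal{I}(v)$ is its set of in-neighbors and $d_{in}(v)=|\mathcal{I}(v)|$. The SimRank matrix $S$ is the solution of $S(i,i)=1$ and, for $i\ne j$, $S(i,j)=\sum_{v_{i'}\in\mathcal{I}(v_i)}\sum_{v_{j'}\in\mathcal{I}(v_j)}\frac{c\,S(i',j')}{d_{in}(v_i)\,d_{in}(v_j)}$ (an empty sum is $0$). The (reverse) transition matrix $P$ is the $n\times n$ matrix with $P(i,j)=1/d_{in}(v_j)$ if $v_i\in\mathcal{I}(v_j)$ and $P(i,j)=0$ otherwise. $\vec{e}_i$ is the $i$-th standard basis column vector. A $\sqrt{c}$-walk from a node is a random walk which at each step moves to a uniformly random in-neighbor of the current node with probability $\sqrt{c}$ and stops at the current node with probability $1-\sqrt{c}$ (it also stops if the current node has no in-neighbor). Two $\sqrt c$-walks started from the same node $v_k$ are said to meet if for some $\ell\ge 1$ both visit the same node at their $\ell$-th step. The basic ExactSim algorithm with input $(G,v_i,\varepsilon)$: (1) Set $L=\lceil\log_{1/c}(2/\varepsilon)\rceil$.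 (2) Compute $\vec{\pi}_i^{\,\ell}=(1-\sqrt{c})(\sqrt{c}P)^{\ell}\vec{e}_i$ for $\ell=0,\dots,L$ and $\vec{\pi}_i=\sum_{\ell=0}^{L}\vec{\pi}_i^{\,\ell}$. (3) Set $R=\frac{6\log n}{(1-\sqrt{c})^4\varepsilon^2}$ (natural logarithm). (4) For each $k=1,\dots,n$, set $R(k)=\lceil R\,\vec{\pi}_i(k)\rceil$, sample $R(k)$ independent pairs of independent $\sqrt{c}$-walks from $v_k$ (independently over different $k$), and let $\hat D(k,k)$ be the fraction of these pairs that do not meet ($\hat D(k,k)=0$ if $R(k)=0$). Let $\hat D$ be the diagonal matrix with these entries. (5) Set $\vec{s}^{0}=\frac{1}{1-\sqrt{c}}\hat D\,\vec{\pi}_i^{\,L}$ and, for $\ell=1,\dots,L$, $\vec{s}^{\ell}=\sqrt{c}\,P^{\top}\vec{s}^{\ell-1}+\frac{1}{1-\sqrt{c}}\hat D\,\vec{\pi}_i^{\,L-\ell}$. Output $\vec{s}^{L}$; equivalently $\vec{s}^{L}=\frac{1}{1-\sqrt{c}}\sum_{\ell=0}^{L}(\sqrt{c}P^{\top})^{\ell}\hat D\,\vec{\pi}_i^{\,\ell}$. *)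

theory Defs
  imports "HOL-Probability.Probability"
begin

text \<open>
  The finite directed graph is given by its edge relation on a finite type of nodes, so the
  number of nodes is the cardinality of the type.
\<close>

definition in_nbrs :: "('n \<times> 'n) set \<Rightarrow> 'n \<Rightarrow> 'n set" where
  "in_nbrs E v = {u. (u, v) \<in> E}"

definition in_deg :: "('n \<times> 'n) set \<Rightarrow> 'n \<Rightarrow> nat" where
  "in_deg E v = card (in_nbrs E v)"

definition is_simrank :: "real \<Rightarrow> ('n::finite \<times> 'n) set \<Rightarrow> real ^ 'n ^ 'n \<Rightarrow> bool" where
  "is_simrank c E S \<longleftrightarrow>
     (\<forall>i j. S $ i $ j =
        (if i = j then 1
         else (\<Sum>i'\<in>in_nbrs E i. \<Sum>j'\<in>in_nbrs E j.
                 c * S $ i' $ j' / (real (in_deg E i) * real (in_deg E j)))))"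

text \<open>Existence and uniqueness for \<open>0 < c < 1\<close> is lemma \<open>ex1_is_simrank\<close> below.\<close>

definition simrank :: "real \<Rightarrow> ('n::finite \<times> 'n) set \<Rightarrow> real ^ 'n ^ 'n" where
  "simrank c E = (THE S. is_simrank c E S)"

definition rev_trans :: "('n::finite \<times> 'n) set \<Rightarrow> real ^ 'n ^ 'n" where
  "rev_trans E = (\<chi> i j. if i \<in> in_nbrs E j then 1 / real (in_deg E j) else 0)"

text \<open>
  A \<open>\<surd>c\<close>-walk from \<open>v\<close> is represented by the list of nodes that it visits, starting with \<open>v\<close>
  itself, so its node at step \<open>l\<close> is the list entry with index \<open>l\<close>, if the walk gets that far.
  The recursion yields a subprobability distribution; it has full mass for \<open>0 < c < 1\<close> (lemma
  \<open>lossless_walk_spmf\<close> below), so that \<open>the\<close> in \<open>sqrtc_walk\<close> is applied to \<open>None\<close> only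
  with probability 0.
\<close>

partial_function (spmf) walk_spmf :: "real \<Rightarrow> ('n::finite \<times> 'n) set \<Rightarrow> 'n \<Rightarrow> 'n list spmf" where
  "walk_spmf c E v =
     bind_spmf (spmf_of_pmf (bernoulli_pmf (sqrt c)))
       (\<lambda>move. if move \<and> in_nbrs E v \<noteq> {}
               then bind_spmf (spmf_of_set (in_nbrs E v))
                      (\<lambda>u. map_spmf (\<lambda>w. v # w) (walk_spmf c E u))
               else return_spmf [v])"

definition sqrtc_walk :: "real \<Rightarrow> ('n::finite \<times> 'n) set \<Rightarrow> 'n \<Rightarrow> 'n list pmf" where
  "sqrtc_walk c E v = map_pmf the (walk_spmf c E v)"

definition walks_meet :: "'n list \<Rightarrow> 'n list \<Rightarrow> bool" where
  "walks_meet xs ys \<longleftrightarrow> (\<exists>l\<ge>1. l < length xs \<and> l < length ys \<and> xs ! l = ys ! l)"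

definition num_iters :: "real \<Rightarrow> real \<Rightarrow> nat" where
  "num_iters c \<epsilon> = nat \<lceil>log (1 / c) (2 / \<epsilon>)\<rceil>"

text \<open>
  Powers of a matrix are iterated matrix-vector products: the power operation on the vector type
  is componentwise.
\<close>

definition ppr_hop :: "real \<Rightarrow> ('n::finite \<times> 'n) set \<Rightarrow> 'n \<Rightarrow> nat \<Rightarrow> real ^ 'n" where
  "ppr_hop c E i l = (1 - sqrt c) *\<^sub>R (((\<lambda>x. (sqrt c *\<^sub>R rev_trans E) *v x) ^^ l) (axis i 1))"

definition ppr :: "real \<Rightarrow> ('n::finite \<times> 'n) set \<Rightarrow> real \<Rightarrow> 'n \<Rightarrow> real ^ 'n" where
  "ppr c E \<epsilon> i = (\<Sum>l\<le>num_iters c \<epsilon>. ppr_hop c E i l)"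

definition num_samples :: "real \<Rightarrow> ('n::finite \<times> 'n) set \<Rightarrow> real \<Rightarrow> 'n \<Rightarrow> 'n \<Rightarrow> nat" where
  "num_samples c E \<epsilon> i k =
     nat \<lceil>(6 * ln (real CARD('n)) / ((1 - sqrt c) ^ 4 * \<epsilon>\<^sup>2)) * ppr c E \<epsilon> i $ k\<rceil>"

text \<open>For \<open>m = 0\<close> the quotient below is \<open>0 / 0 = 0\<close>, as required.\<close>

definition diag_estimate :: "real \<Rightarrow> ('n::finite \<times> 'n) set \<Rightarrow> nat \<Rightarrow> 'n \<Rightarrow> real pmf" where
  "diag_estimate c E m k =
     map_pmf (\<lambda>ps. real (length (filter (\<lambda>(xs, ys). \<not> walks_meet xs ys) ps)) / real m)
       (replicate_pmf m (pair_pmf (sqrtc_walk c E k) (sqrtc_walk c E k)))"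

definition D_hat :: "real \<Rightarrow> ('n::finite \<times> 'n) set \<Rightarrow> real \<Rightarrow> 'n \<Rightarrow> (real ^ 'n ^ 'n) pmf" where
  "D_hat c E \<epsilon> i =
     map_pmf (\<lambda>d. \<chi> a b. if a = b then d a else 0)
       (Pi_pmf UNIV 0 (\<lambda>k. diag_estimate c E (num_samples c E \<epsilon> i k) k))"

primrec exactsim_iter ::
    "real \<Rightarrow> ('n::finite \<times> 'n) set \<Rightarrow> real \<Rightarrow> 'n \<Rightarrow> real ^ 'n ^ 'n \<Rightarrow> nat \<Rightarrow> real ^ 'n" where
  "exactsim_iter c E \<epsilon> i D 0 =
     (1 / (1 - sqrt c)) *\<^sub>R (D *v ppr_hop c E i (num_iters c \<epsilon>))"
| "exactsim_iter c E \<epsilon> i D (Suc l) =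
     sqrt c *\<^sub>R (transpose (rev_trans E) *v exactsim_iter c E \<epsilon> i D l)
     + (1 / (1 - sqrt c)) *\<^sub>R (D *v ppr_hop c E i (num_iters c \<epsilon> - Suc l))"

text \<open>The distribution of the output vector for the source \<open>i\<close>.\<close>

definition exactsim :: "real \<Rightarrow> ('n::finite \<times> 'n) set \<Rightarrow> real \<Rightarrow> 'n \<Rightarrow> (real ^ 'n) pmf" where
  "exactsim c E \<epsilon> i =
     map_pmf (\<lambda>D. exactsim_iter c E \<epsilon> i D (num_iters c \<epsilon>)) (D_hat c E \<epsilon> i)"


text \<open>The two well-definedness facts.\<close>

lemma ex1_is_simrank:
  fixes E :: "('n::finite \<times> 'n) set" and c :: real
  assumes c: "0 < c" "c < 1"
  shows "\<exists>!S. is_simrank c E S"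
proof -
  define A :: "real ^ 'n ^ 'n \<Rightarrow> real ^ 'n ^ 'n" where
    "A = (\<lambda>S. \<chi> i j. if i = j then 0
         else (\<Sum>i'\<in>in_nbrs E i. \<Sum>j'\<in>in_nbrs E j.
                 c * S $ i' $ j' / (real (in_deg E i) * real (in_deg E j))))"
  have lin: "linear (\<lambda>S. S - A S)"
    by (rule linearI)
       (auto simp: A_def vec_eq_iff algebra_simps sum.distrib add_divide_distrib sum_distrib_left)
  have eq: "is_simrank c E S \<longleftrightarrow> S - A S = mat 1" for S
    by (auto simp: is_simrank_def A_def vec_eq_iff mat_def algebra_simps)
  have zero: "S = 0" if "S - A S = 0" for S
  proof -
    define m where "m = Max (range (\<lambda>(i, j). \<bar>S $ i $ j\<bar>))"
    have le: "\<bar>S $ i $ j\<bar> \<le> m" for i j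
      unfolding m_def by (rule Max_ge) (auto intro!: image_eqI[of _ _ "(i, j)"])
    have m0: "0 \<le> m" using le[of undefined undefined] by linarith
    have "m \<in> range (\<lambda>(i, j). \<bar>S $ i $ j\<bar>)"
      unfolding m_def by (rule Max_in) auto
    then obtain i j where ij: "m = \<bar>S $ i $ j\<bar>" by auto
    have SA: "S $ i $ j = A S $ i $ j" using that by (metis eq_iff_diff_eq_0)
    have "m \<le> c * m"
    proof (cases "i = j")
      case True
      then show ?thesis using ij SA c m0 by (simp add: A_def)
    next
      case False
      let ?a = "real (in_deg E i)" and ?b = "real (in_deg E j)"
      have "m = \<bar>\<Sum>i'\<in>in_nbrs E i. \<Sum>j'\<in>in_nbrs E j. c * S $ i' $ j' / (?a * ?b)\<bar>"
        using ij SA False by (simp add: A_def)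
      also have "\<dots> \<le> (\<Sum>i'\<in>in_nbrs E i. \<Sum>j'\<in>in_nbrs E j. c * m / (?a * ?b))"
        by (intro order_trans[OF sum_abs] sum_mono)
           (use c le in \<open>auto simp: abs_mult intro!: divide_right_mono mult_left_mono\<close>)
      also have "\<dots> = ?a * (?b * (c * m / (?a * ?b)))"
        by (simp add: in_deg_def)
      also have "\<dots> \<le> c * m"
        using c m0 by (cases "?a = 0 \<or> ?b = 0") auto
      finally show ?thesis .
    qed
    then have "m = 0"
      using c m0 by (metis leD mult_less_cancel_right2 nless_le)
    then show "S = 0" using le by (simp add: vec_eq_iff)
  qed
  have inj: "inj (\<lambda>S. S - A S)"
    using zero linear_injective_0[OF lin] by blast
  then have "surj (\<lambda>S. S - A S)"
    by (intro linear_inj_imp_surj[OF lin])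
  then obtain S where "S - A S = mat 1"
    by (blast dest: surjD[of _ "mat 1"] sym)
  then have "is_simrank c E S" by (simp only: eq)
  then show ?thesis
  proof (rule ex1I)
    fix T assume "is_simrank c E T"
    then have "T - A T = S - A S" using \<open>S - A S = mat 1\<close> by (simp only: eq)
    then show "T = S" by (rule injD[OF inj])
  qed
qed

lemma lossless_walk_spmf:
  fixes E :: "('n::finite \<times> 'n) set" and c :: real
  assumes c: "0 < c" "c < 1"
  shows "lossless_spmf (walk_spmf c E v)"
proof -
  define w where "w = (\<lambda>v. weight_spmf (walk_spmf c E v))"
  define m where "m = Min (range w)"
  have sc: "0 < sqrt c" "sqrt c < 1" using c by auto
  have le: "m \<le> w u" for u unfolding m_def by (rule Min_le) auto
  have w1: "w u \<le> 1" for u unfolding w_def by (rule weight_spmf_le_1)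
  have "m \<in> range w" unfolding m_def by (rule Min_in) auto
  then obtain x where x: "m = w x" by auto
  have "1 \<le> m"
  proof (cases "in_nbrs E x = {}")
    case True
    then have "w x = 1"
      using sc by (simp add: w_def walk_spmf.simps[of c E x] weight_bind_spmf)
    then show ?thesis using x by simp
  next
    case False
    have "w x = sqrt c * (\<Sum>u\<in>in_nbrs E x. w u) / card (in_nbrs E x) + (1 - sqrt c)"
    proof -
      let ?step = "\<lambda>u. map_spmf (\<lambda>w. x # w) (walk_spmf c E u)"
      have "w x = integral\<^sup>L (measure_pmf (bernoulli_pmf (sqrt c)))
              (weight_spmf \<circ> (\<lambda>move. if move \<and> in_nbrs E x \<noteq> {}
                 then bind_spmf (spmf_of_set (in_nbrs E x)) ?step else return_spmf [x]))"
        unfolding w_def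
        by (rule trans[OF arg_cong[of _ _ weight_spmf, OF walk_spmf.simps]])
           (simp only: weight_bind_spmf measure_spmf_spmf_of_pmf)
      also have "\<dots> = sqrt c * weight_spmf (bind_spmf (spmf_of_set (in_nbrs E x)) ?step)
                        + (1 - sqrt c)"
        using sc False by simp
      also have "weight_spmf (bind_spmf (spmf_of_set (in_nbrs E x)) ?step)
                   = (\<Sum>u\<in>in_nbrs E x. w u) / card (in_nbrs E x)"
        by (simp only: weight_bind_spmf integral_spmf_of_set o_def weight_map_spmf w_def)
      finally show ?thesis by simp
    qed
    moreover have "card (in_nbrs E x) * m \<le> (\<Sum>u\<in>in_nbrs E x. w u)"
      using sum_mono[of "in_nbrs E x" "\<lambda>_. m" w] le by simp
    then have "m \<le> (\<Sum>u\<in>in_nbrs E x. w u) / card (in_nbrs E x)"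
      using False by (simp add: pos_le_divide_eq card_gt_0_iff mult.commute)
    then have "sqrt c * m \<le> sqrt c * (\<Sum>u\<in>in_nbrs E x. w u) / card (in_nbrs E x)"
      using sc by (metis mult_left_mono less_imp_le times_divide_eq_right)
    ultimately have "(1 - sqrt c) * 1 \<le> (1 - sqrt c) * m" using x by (simp add: algebra_simps)
    then show ?thesis using sc by simp
  qed
  then show ?thesis
    using le[of v] w1[of v] by (simp add: lossless_spmf_def w_def)
qed

end

(*
With A = sqrt c P, the SimRank matrix satisfies S = A^T S A + D, where D(k,k) is the probability
that two walks from v_k do not meet: replacing S(i,j) by meeting probabilities solves the SimRank
equations, which determine S. Unrolling L + 1 times,
  S(i,j) = sum_k D(k,k) w_k + rho,   w_k = sum_{l <= L} (A^l e_i)(k) (A^l e_j)(k),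
with 0 <= rho <= c^(L+1) <= c eps / 2, whereas the output is s^L(j) = sum_k Dhat(k,k) w_k.
Since w_k <= pi_i(k) / (1 - sqrt c) and sum_k w_k <= 1 / (1 - c), Hoeffding's bound for a deviation
of (1 - sqrt c) eps <= eps - c eps / 2 gives failure probability at most 2 n^(-12) for each pair
(i,j). A union bound over the n^2 pairs needs no independence between the sources.
The stronger truncation bound c eps / 2 (rather than eps / 2) is needed: splitting the error evenly
would give only about 2 / n^3 for a single pair when c is small.
*)
theory Submission
  imports Defs
begin

subsection \<open>Meeting probabilities of walks\<close>

lemma walk_spmf_eq_sqrtc_walk:
  assumes "0 < c" "c < 1"
  shows "walk_spmf c E v = spmf_of_pmf (sqrtc_walk c E v)"
proof -
  obtain p where p: "walk_spmf c E v = spmf_of_pmf p"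
    using lossless_walk_spmf[OF assms] lossless_spmf_conv_spmf_of_pmf by blast
  then have "sqrtc_walk c E v = p"
    by (simp add: sqrtc_walk_def spmf_of_pmf_def pmf.map_comp o_def)
  with p show ?thesis by simp
qed

text \<open>The recursion is available only for \<open>walk_spmf\<close>. It carries over because no
  mass is lost and the embedding \<open>spmf_of_pmf\<close> is injective.\<close>

lemma sqrtc_walk_unfold:
  fixes E :: "('n::finite \<times> 'n) set"
  assumes "0 < c" "c < 1"
  shows "sqrtc_walk c E v =
     bind_pmf (bernoulli_pmf (sqrt c))
       (\<lambda>move. if move \<and> in_nbrs E v \<noteq> {}
               then bind_pmf (pmf_of_set (in_nbrs E v)) (\<lambda>u. map_pmf ((#) v) (sqrtc_walk c E u))
               else return_pmf [v])"
    (is "_ = ?rhs")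
proof -
  have "spmf_of_pmf (sqrtc_walk c E v) = spmf_of_pmf ?rhs"
    unfolding walk_spmf_eq_sqrtc_walk[OF assms, symmetric]
    by (subst walk_spmf.simps)
       (auto simp: walk_spmf_eq_sqrtc_walk[OF assms] spmf_of_pmf_bind if_distrib
          simp flip: spmf_of_pmf_pmf_of_set spmf_of_pmf_return_pmf
          intro!: bind_pmf_cong)
  then show ?thesis
    by (simp add: spmf_of_pmf_def pmf.inj_map_strong inj_eq[OF pmf.inj_map])
qed

lemma sqrtc_walk_starts_at:
  assumes "0 < c" "c < 1" "w \<in> set_pmf (sqrtc_walk c E v)"
  shows "\<exists>w'. w = v # w'"
  using assms(3) by (subst (asm) sqrtc_walk_unfold[OF assms(1,2)]) (auto split: if_splits)

text \<open>First-step analysis for an arbitrary continuation \<open>K\<close>. The stopping branch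
  yields the walk \<open>[v]\<close> and contributes nothing by the assumption on
  \<open>K [v]\<close>; at a node without in-neighbors both sides are zero.\<close>

lemma pmf_bind_sqrtc_walk:
  fixes E :: "('n::finite \<times> 'n) set"
  assumes c: "0 < c" "c < 1" and K: "pmf (K [v]) b = 0"
  shows "pmf (bind_pmf (sqrtc_walk c E v) K) b =
           sqrt c * (\<Sum>u\<in>in_nbrs E v. pmf (bind_pmf (sqrtc_walk c E u) (\<lambda>w. K (v # w))) b)
             / real (in_deg E v)"
proof (cases "in_nbrs E v = {}")
  case True
  then show ?thesis
    using K by (subst sqrtc_walk_unfold[OF c]) (simp add: bind_return_pmf)
next
  case False
  have eq: "bind_pmf (sqrtc_walk c E v) K =
     bind_pmf (bernoulli_pmf (sqrt c))
       (\<lambda>move. if move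
               then bind_pmf (pmf_of_set (in_nbrs E v))
                      (\<lambda>u. bind_pmf (sqrtc_walk c E u) (\<lambda>w. K (v # w)))
               else K [v])"
    unfolding sqrtc_walk_unfold[OF c, of E v] bind_assoc_pmf using False
    by (intro bind_pmf_cong refl) (simp add: bind_assoc_pmf bind_map_pmf bind_return_pmf)
  show ?thesis
    unfolding eq using False c K
    by (simp add: pmf_bind integral_pmf_of_set in_deg_def)
qed

text \<open>Nested binds, unlike a product distribution, let \<open>pmf_bind_sqrtc_walk\<close> act
  on either walk in turn. As \<open>walks_meet\<close> ignores step 0, the value for
  \<open>u = v\<close> is the probability of meeting again.\<close>

definition meet_prob :: "real \<Rightarrow> ('n::finite \<times> 'n) set \<Rightarrow> 'n \<Rightarrow> 'n \<Rightarrow> real" where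
  "meet_prob c E u v =
     pmf (bind_pmf (sqrtc_walk c E u) (\<lambda>xs. bind_pmf (sqrtc_walk c E v)
            (\<lambda>ys. return_pmf (walks_meet xs ys)))) True"

lemma walks_meet_singleton [simp]: "\<not> walks_meet [u] ys" "\<not> walks_meet xs [v]"
  by (auto simp: walks_meet_def)

text \<open>Index 0 of the tails is step 1 of the full walks, which counts, but
  \<open>walks_meet\<close> on the tails ignores it; hence the separate disjunct
  \<open>a = b\<close>.\<close>

lemma walks_meet_Cons:
  "walks_meet (u # a # xs) (v # b # ys) \<longleftrightarrow> a = b \<or> walks_meet (a # xs) (b # ys)"
proof
  assume "walks_meet (u # a # xs) (v # b # ys)"
  then obtain l where "l \<ge> 1" "l < length (u # a # xs)" "l < length (v # b # ys)"
    "(u # a # xs) ! l = (v # b # ys) ! l"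
    by (auto simp: walks_meet_def)
  then show "a = b \<or> walks_meet (a # xs) (b # ys)"
    unfolding walks_meet_def by (cases l; cases "l - 1") (auto intro!: exI[of _ "l - 1"])
next
  assume "a = b \<or> walks_meet (a # xs) (b # ys)"
  then show "walks_meet (u # a # xs) (v # b # ys)"
  proof
    assume "a = b" then show ?thesis
      unfolding walks_meet_def by (intro exI[of _ 1]) auto
  next
    assume "walks_meet (a # xs) (b # ys)"
    then obtain l where "l \<ge> 1" "l < length (a # xs)" "l < length (b # ys)"
      "(a # xs) ! l = (b # ys) ! l"
      by (auto simp: walks_meet_def)
    then show ?thesis
      unfolding walks_meet_def by (intro exI[of _ "Suc l"]) auto
  qed
qed

lemma meet_prob_Cons:
  assumes c: "0 < c" "c < 1"
  shows "pmf (bind_pmf (sqrtc_walk c E a) (\<lambda>xs. bind_pmf (sqrtc_walk c E b)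
            (\<lambda>ys. return_pmf (walks_meet (u # xs) (v # ys))))) True
         = (if a = b then 1 else meet_prob c E a b)"
proof -
  have "bind_pmf (sqrtc_walk c E a) (\<lambda>xs. bind_pmf (sqrtc_walk c E b)
            (\<lambda>ys. return_pmf (walks_meet (u # xs) (v # ys))))
      = bind_pmf (sqrtc_walk c E a) (\<lambda>xs. bind_pmf (sqrtc_walk c E b)
            (\<lambda>ys. return_pmf (a = b \<or> walks_meet xs ys)))"
    by (intro bind_pmf_cong refl) (auto dest!: sqrtc_walk_starts_at[OF c] simp: walks_meet_Cons)
  then show ?thesis by (simp add: meet_prob_def)
qed

text \<open>First-step analysis of both walks: each move contributes a factor \<open>sqrt c\<close>
  and a uniform in-neighbor, and walks that then stand on one node have met. The case
  \<open>u = v\<close> later supplies the diagonal correction.\<close>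

lemma meet_prob_eq:
  fixes E :: "('n::finite \<times> 'n) set"
  assumes c: "0 < c" "c < 1"
  shows "meet_prob c E u v =
           (\<Sum>a\<in>in_nbrs E u. \<Sum>b\<in>in_nbrs E v.
              c * (if a = b then 1 else meet_prob c E a b) / (real (in_deg E u) * real (in_deg E v)))"
proof -
  have *: "pmf (bind_pmf (sqrtc_walk c E a)
              (\<lambda>xs. bind_pmf (sqrtc_walk c E v) (\<lambda>ys. return_pmf (walks_meet (u # xs) ys)))) True
     = sqrt c * (\<Sum>b\<in>in_nbrs E v. if a = b then 1 else meet_prob c E a b) / real (in_deg E v)"
    for a
    \<comment> \<open>Swapping the independent draws brings the walk from \<open>v\<close> to the
      front for its first step; the second swap restores the order.\<close>
    unfolding bind_commute_pmf[of "sqrtc_walk c E a"]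
    by (subst pmf_bind_sqrtc_walk[OF c])
       (simp_all add: bind_commute_pmf[of _ "sqrtc_walk c E a"] meet_prob_Cons[OF c])
  have sq: "sqrt c * (sqrt c * x) = c * x" for x
    using c by (simp flip: mult.assoc)
  show ?thesis
    unfolding meet_prob_def[of c E u v]
    by (subst pmf_bind_sqrtc_walk[OF c])
       (simp_all add: * sum_distrib_left sum_divide_distrib sq mult_ac)
qed

lemma simrank_eq_meet_prob:
  assumes c: "0 < c" "c < 1"
  shows "simrank c E $ i $ j = (if i = j then 1 else meet_prob c E i j)"
proof -
  define T where "T = (\<chi> i j. if i = j then 1 else meet_prob c E i j)"
  have "is_simrank c E T"
    unfolding is_simrank_def T_def using meet_prob_eq[OF c, of E] by simp
  then have "simrank c E = T"
    unfolding simrank_def using ex1_is_simrank[OF c, of E] by (metis the1_equality)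
  then show ?thesis by (simp add: T_def)
qed


subsection \<open>The linear recurrence\<close>

text \<open>The start vector is arbitrary because moving a transposed matrix across an inner product
  changes it at each step.\<close>

definition hop :: "real \<Rightarrow> ('n::finite \<times> 'n) set \<Rightarrow> nat \<Rightarrow> real ^ 'n \<Rightarrow> real ^ 'n" where
  "hop c E l = (\<lambda>x. (sqrt c *\<^sub>R rev_trans E) *v x) ^^ l"

lemma hop_0 [simp]: "hop c E 0 y = y"
  by (simp add: hop_def)

lemma hop_Suc: "hop c E (Suc l) y = (sqrt c *\<^sub>R rev_trans E) *v hop c E l y"
  by (simp add: hop_def)

lemma hop_Suc': "hop c E (Suc l) y = hop c E l ((sqrt c *\<^sub>R rev_trans E) *v y)"
  by (simp add: hop_def funpow_swap1)

lemma ppr_hop_eq_hop: "ppr_hop c E i l = (1 - sqrt c) *\<^sub>R hop c E l (axis i 1)"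
  by (simp add: ppr_hop_def hop_def)

lemma rev_trans_nonneg: "0 \<le> rev_trans E $ a $ b"
  by (simp add: rev_trans_def)

text \<open>A column sums to 1, or to 0 if its node has no in-neighbor.\<close>

lemma sum_rev_trans_le: "(\<Sum>a\<in>UNIV. rev_trans E $ a $ b) \<le> 1"
  by (simp add: rev_trans_def in_deg_def sum.If_cases)

lemma hop_nonneg:
  assumes "0 \<le> c" "\<And>k. 0 \<le> y $ k"
  shows "0 \<le> hop c E l y $ k"
  using assms
  by (induction l arbitrary: k)
     (auto simp: hop_Suc matrix_vector_mult_def rev_trans_nonneg intro!: sum_nonneg mult_nonneg_nonneg)

lemma sum_hop_le:
  assumes "0 \<le> c" "\<And>k. 0 \<le> y $ k"
  shows "(\<Sum>k\<in>UNIV. hop c E l y $ k) \<le> sqrt c ^ l * (\<Sum>k\<in>UNIV. y $ k)"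
proof (induction l)
  case (Suc l)
  let ?z = "hop c E l y"
  have "(\<Sum>k\<in>UNIV. hop c E (Suc l) y $ k)
      = sqrt c * (\<Sum>b\<in>UNIV. (\<Sum>a\<in>UNIV. rev_trans E $ a $ b) * ?z $ b)"
    unfolding hop_Suc matrix_vector_mult_def
    by (simp add: sum_distrib_left sum_distrib_right mult.assoc, subst sum.swap, rule refl)
  also have "\<dots> \<le> sqrt c * (\<Sum>b\<in>UNIV. 1 * ?z $ b)"
    by (intro mult_left_mono sum_mono mult_right_mono sum_rev_trans_le hop_nonneg assms) (use assms in auto)
  also have "\<dots> \<le> sqrt c * (sqrt c ^ l * (\<Sum>k\<in>UNIV. y $ k))"
    using Suc.IH assms by (intro mult_left_mono) auto
  finally show ?case by (simp add: mult.assoc)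
qed simp

lemma sum_axis: "(\<Sum>k\<in>UNIV. axis i (1::real) $ k) = 1"
  by (simp add: axis_def)

lemma hop_axis_nonneg:
  assumes "0 \<le> c"
  shows "0 \<le> hop c E l (axis i 1) $ k"
  using assms by (intro hop_nonneg) (auto simp: axis_def)

lemma sum_hop_axis_le:
  assumes "0 \<le> c"
  shows "(\<Sum>k\<in>UNIV. hop c E l (axis i 1) $ k) \<le> sqrt c ^ l"
  using sum_hop_le[of c "axis i 1" E l] assms by (simp add: sum_axis axis_def)

lemma hop_axis_le:
  assumes "0 \<le> c"
  shows "hop c E l (axis i 1) $ k \<le> sqrt c ^ l"
proof -
  have "hop c E l (axis i 1) $ k \<le> (\<Sum>k\<in>UNIV. hop c E l (axis i 1) $ k)"
    using assms by (intro member_le_sum) (auto intro: hop_axis_nonneg)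
  then show ?thesis using sum_hop_axis_le[OF assms] by (rule order_trans)
qed

section \<open>Output and SimRank as weighted sums of diagonal entries\<close>

lemma inner_transpose:
  fixes A :: "real ^ 'n ^ 'm"
  shows "(transpose A *v y) \<bullet> z = y \<bullet> (A *v z)"
  by (simp add: dot_lmul_matrix)

definition diag_mat :: "('n \<Rightarrow> real) \<Rightarrow> real ^ 'n ^ 'n" where
  "diag_mat d = (\<chi> a b. if a = b then d a else 0)"

lemma diag_mat_inner: "(diag_mat d *v y) \<bullet> z = (\<Sum>k\<in>UNIV. d k * (y $ k * z $ k))"
  by (simp add: diag_mat_def inner_vec_def matrix_vector_mult_def if_distrib if_distribR
                sum.delta mult.assoc cong: if_cong)

text \<open>Testing against an arbitrary \<open>z\<close> turns the transposed matrix of the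
  recursion into the matrix itself acting on \<open>z\<close>. The term with \<open>m\<close> steps
  on \<open>z\<close> was added in round \<open>l - m\<close>, which explains its other hop
  index.\<close>

lemma exactsim_iter_inner:
  assumes "l \<le> num_iters c \<epsilon>" "c < 1"
  shows "exactsim_iter c E \<epsilon> i D l \<bullet> z =
           (\<Sum>m\<le>l. (D *v hop c E (num_iters c \<epsilon> - l + m) (axis i 1)) \<bullet> hop c E m z)"
  using assms(1)
proof (induction l arbitrary: z)
  case 0
  then show ?case using assms(2) by (simp add: ppr_hop_eq_hop matrix_vector_mult_scaleR)
next
  case (Suc l)
  have "exactsim_iter c E \<epsilon> i D (Suc l) \<bullet> z
      = exactsim_iter c E \<epsilon> i D l \<bullet> ((sqrt c *\<^sub>R rev_trans E) *v z)
        + (D *v hop c E (num_iters c \<epsilon> - Suc l) (axis i 1)) \<bullet> z"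
    using assms(2) inner_transpose[of "rev_trans E" "exactsim_iter c E \<epsilon> i D l" z]
    by (simp add: inner_add_left ppr_hop_eq_hop matrix_vector_mult_scaleR del: transpose_matrix_vector
             flip: scaleR_matrix_vector_assoc)
  \<comment> \<open>The truncated subtraction shifts by exactly one because \<open>Suc l\<close> is
    at most \<open>num_iters c \<epsilon>\<close>; the freshly added summand becomes the term for
    \<open>m = 0\<close>.\<close>
  also have "\<dots> = (\<Sum>m\<le>l. (D *v hop c E (num_iters c \<epsilon> - Suc l + Suc m) (axis i 1)) \<bullet> hop c E (Suc m) z)
        + (D *v hop c E (num_iters c \<epsilon> - Suc l) (axis i 1)) \<bullet> z"
    using Suc by (simp add: hop_Suc' Suc_diff_Suc Suc_diff_le)
  finally show ?case by (simp add: sum.atMost_Suc_shift del: sum.atMost_Suc)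
qed

text \<open>The weight of the diagonal entry at \<open>k\<close>, common to the output and to the
  unrolled SimRank equation, so that the two differ only in the diagonal entries and the truncated
  tail.\<close>

definition overlap :: "real \<Rightarrow> ('n::finite \<times> 'n) set \<Rightarrow> nat \<Rightarrow> 'n \<Rightarrow> 'n \<Rightarrow> 'n \<Rightarrow> real" where
  "overlap c E L i j k = (\<Sum>l\<le>L. hop c E l (axis i 1) $ k * hop c E l (axis j 1) $ k)"

lemma exactsim_iter_diag_mat:
  assumes "c < 1"
  shows "exactsim_iter c E \<epsilon> i (diag_mat d) (num_iters c \<epsilon>) $ j
           = (\<Sum>k\<in>UNIV. d k * overlap c E (num_iters c \<epsilon>) i j k)"
proof -
  have "exactsim_iter c E \<epsilon> i (diag_mat d) (num_iters c \<epsilon>) $ j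
      = exactsim_iter c E \<epsilon> i (diag_mat d) (num_iters c \<epsilon>) \<bullet> axis j 1"
    by (simp add: inner_axis)
  also have "\<dots> = (\<Sum>m\<le>num_iters c \<epsilon>. \<Sum>k\<in>UNIV. d k * (hop c E m (axis i 1) $ k * hop c E m (axis j 1) $ k))"
    by (subst exactsim_iter_inner) (simp_all add: assms diag_mat_inner)
  also have "\<dots> = (\<Sum>k\<in>UNIV. d k * overlap c E (num_iters c \<epsilon>) i j k)"
    unfolding overlap_def sum_distrib_left by (rule sum.swap)
  finally show ?thesis .
qed

text \<open>Off the diagonal this is the SimRank equation in matrix form; on the diagonal the
  product falls short of 1 by exactly \<open>d k\<close>.\<close>

lemma is_simrank_decomp:
  assumes "0 \<le> c" and S: "is_simrank c E S"
    and d: "\<And>k. d k = 1 - (\<Sum>a\<in>in_nbrs E k. \<Sum>b\<in>in_nbrs E k.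
                 c * S $ a $ b / (real (in_deg E k) * real (in_deg E k)))"
  shows "S = transpose (sqrt c *\<^sub>R rev_trans E) ** S ** (sqrt c *\<^sub>R rev_trans E) + diag_mat d"
proof -
  let ?A = "sqrt c *\<^sub>R rev_trans E"
  have *: "(transpose ?A ** S ** ?A) $ i $ j = (\<Sum>a\<in>in_nbrs E i. \<Sum>b\<in>in_nbrs E j.
                 c * S $ a $ b / (real (in_deg E i) * real (in_deg E j)))" for i j
  proof -
    have sq: "sqrt c * (sqrt c * x) = c * x" for x
      using assms(1) by (simp flip: mult.assoc)
    have "(transpose ?A ** S ** ?A) $ i $ j = (\<Sum>b\<in>UNIV. \<Sum>a\<in>UNIV. ?A $ a $ i * S $ a $ b * ?A $ b $ j)"
      by (simp add: matrix_matrix_mult_def transpose_def sum_distrib_right)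
    also have "\<dots> = (\<Sum>b\<in>UNIV. \<Sum>a\<in>UNIV. if b \<in> in_nbrs E j then if a \<in> in_nbrs E i then
                 c * S $ a $ b / (real (in_deg E i) * real (in_deg E j)) else 0 else 0)"
      by (intro sum.cong refl) (simp add: rev_trans_def sq mult_ac)
    also have "\<dots> = (\<Sum>b\<in>in_nbrs E j. \<Sum>a\<in>in_nbrs E i.
                 c * S $ a $ b / (real (in_deg E i) * real (in_deg E j)))"
      by (simp add: sum.If_cases if_distrib[of "sum _"] cong: if_cong)
    finally show ?thesis by (subst sum.swap)
  qed
  have "S $ i $ j = (transpose ?A ** S ** ?A + diag_mat d) $ i $ j" for i j
    using S[unfolded is_simrank_def, rule_format, of i j] 
    unfolding vector_add_component * by (auto simp: d diag_mat_def)
  then show ?thesis by (simp add: vec_eq_iff)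
qed

text \<open>Each use of the fixed-point equation moves one matrix factor from either side of
  \<open>S\<close> onto the vectors and leaves one term in \<open>D\<close>.\<close>

lemma bilinear_unfold:
  fixes S :: "real ^ 'n ^ 'n"
  assumes "S = transpose (sqrt c *\<^sub>R rev_trans E) ** S ** (sqrt c *\<^sub>R rev_trans E) + D"
  shows "y \<bullet> (S *v z) =
           (\<Sum>l<N. hop c E l y \<bullet> (D *v hop c E l z)) + hop c E N y \<bullet> (S *v hop c E N z)"
proof (induction N)
  case (Suc N)
  let ?A = "sqrt c *\<^sub>R rev_trans E"
  have "y' \<bullet> (S *v z') = (?A *v y') \<bullet> (S *v (?A *v z')) + y' \<bullet> (D *v z')" for y' z'
    by (subst assms, subst matrix_vector_mult_add_rdistrib)
       (simp only: inner_add_right inner_transpose inner_commute[of y'] flip: matrix_vector_mul_assoc, simp add: inner_commute)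
  from this[of "hop c E N y" "hop c E N z"] Suc show ?case
    by (simp add: hop_Suc)
qed simp

text \<open>Unrolling \<open>Suc L\<close> times collects the hops 0 to \<open>L\<close>. The
  remainder pairs two nonnegative vectors of mass at most \<open>sqrt c ^ Suc L\<close> through a
  matrix with entries in \<open>{0..1}\<close>.\<close>

lemma simrank_decomp:
  assumes c: "0 \<le> c" "c < 1" and S: "is_simrank c E S"
    and d: "\<And>k. d k = 1 - (\<Sum>a\<in>in_nbrs E k. \<Sum>b\<in>in_nbrs E k.
                 c * S $ a $ b / (real (in_deg E k) * real (in_deg E k)))"
    and S01: "\<And>a b. S $ a $ b \<in> {0..1}"
  shows "S $ i $ j - (\<Sum>k\<in>UNIV. d k * overlap c E L i j k) \<in> {0..c ^ Suc L}"
proof -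
  let ?h = "\<lambda>l i. hop c E l (axis i 1)"
  have "S $ i $ j = axis i 1 \<bullet> (S *v axis j 1)"
    by (simp add: inner_axis' matrix_vector_mul_component inner_axis)
  also have "\<dots> = (\<Sum>l<Suc L. ?h l i \<bullet> (diag_mat d *v ?h l j)) + ?h (Suc L) i \<bullet> (S *v ?h (Suc L) j)"
    by (rule bilinear_unfold[OF is_simrank_decomp[OF c(1) S d]])
  also have "(\<Sum>l<Suc L. ?h l i \<bullet> (diag_mat d *v ?h l j)) = (\<Sum>l\<le>L. \<Sum>k\<in>UNIV. d k * (?h l i $ k * ?h l j $ k))"
    unfolding lessThan_Suc_atMost by (subst inner_commute) (simp add: diag_mat_inner mult_ac)
  also have "\<dots> = (\<Sum>k\<in>UNIV. d k * overlap c E L i j k)"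
    unfolding overlap_def sum_distrib_left by (rule sum.swap)
  also have "?h (Suc L) i \<bullet> (S *v ?h (Suc L) j)
      = (\<Sum>a\<in>UNIV. \<Sum>b\<in>UNIV. ?h (Suc L) i $ a * (S $ a $ b * ?h (Suc L) j $ b))"
    by (simp add: inner_vec_def matrix_vector_mult_def sum_distrib_left)
  finally have eq: "S $ i $ j - (\<Sum>k\<in>UNIV. d k * overlap c E L i j k) =
    (\<Sum>a\<in>UNIV. \<Sum>b\<in>UNIV. ?h (Suc L) i $ a * (S $ a $ b * ?h (Suc L) j $ b))"
    by simp
  have "(\<Sum>a\<in>UNIV. \<Sum>b\<in>UNIV. ?h (Suc L) i $ a * (S $ a $ b * ?h (Suc L) j $ b))
     \<le> (\<Sum>a\<in>UNIV. \<Sum>b\<in>UNIV. ?h (Suc L) i $ a * (1 * ?h (Suc L) j $ b))"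
    using S01 c by (intro sum_mono mult_left_mono mult_right_mono hop_axis_nonneg) auto
  also have "\<dots> = (\<Sum>a\<in>UNIV. ?h (Suc L) i $ a) * (\<Sum>b\<in>UNIV. ?h (Suc L) j $ b)"
    by (simp add: sum_product)
  also have "\<dots> \<le> sqrt c ^ Suc L * sqrt c ^ Suc L"
    using c by (intro mult_mono sum_hop_axis_le sum_nonneg hop_axis_nonneg) auto
  also have "\<dots> = c ^ Suc L"
    using c by (simp del: power_Suc flip: power_mult_distrib)
  finally have "S $ i $ j - (\<Sum>k\<in>UNIV. d k * overlap c E L i j k) \<le> c ^ Suc L"
    unfolding eq .
  moreover have "0 \<le> S $ i $ j - (\<Sum>k\<in>UNIV. d k * overlap c E L i j k)"
    unfolding eq using S01 c by (intro sum_nonneg mult_nonneg_nonneg hop_axis_nonneg) auto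
  ultimately show ?thesis by simp
qed

section \<open>Bounds on the overlap weights and on the truncation error\<close>

lemma overlap_nonneg:
  assumes "0 \<le> c"
  shows "0 \<le> overlap c E L i j k"
  unfolding overlap_def using assms by (intro sum_nonneg mult_nonneg_nonneg hop_axis_nonneg) auto

lemma ppr_eq_sum_hop: "ppr c E \<epsilon> i $ k = (1 - sqrt c) * (\<Sum>l\<le>num_iters c \<epsilon>. hop c E l (axis i 1) $ k)"
  by (simp add: ppr_def ppr_hop_eq_hop sum_distrib_left)

text \<open>Bounding the hops from \<open>j\<close> by 1 leaves the summed hops from
  \<open>i\<close>. This ties the weight at \<open>k\<close> to the number of samples drawn
  there.\<close>

lemma overlap_le_ppr:
  assumes "0 \<le> c" "c < 1"
  shows "overlap c E (num_iters c \<epsilon>) i j k \<le> ppr c E \<epsilon> i $ k / (1 - sqrt c)"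
proof -
  have "hop c E l (axis j 1) $ k \<le> 1" for l
    using hop_axis_le[of c E l j k] power_le_one[of "sqrt c" l] assms by auto
  then have "overlap c E (num_iters c \<epsilon>) i j k \<le> (\<Sum>l\<le>num_iters c \<epsilon>. hop c E l (axis i 1) $ k * 1)"
    unfolding overlap_def using assms by (intro sum_mono mult_left_mono hop_axis_nonneg) auto
  also have "\<dots> = ppr c E \<epsilon> i $ k / (1 - sqrt c)"
    using assms by (simp add: ppr_eq_sum_hop)
  finally show ?thesis .
qed

text \<open>One hop vector is bounded entrywise by \<open>sqrt c ^ l\<close>, the other in total
  mass by the same power, which gives a geometric series in \<open>c\<close>.\<close>

lemma sum_overlap_le:
  assumes "0 \<le> c" "c < 1"
  shows "(\<Sum>k\<in>UNIV. overlap c E L i j k) \<le> 1 / (1 - c)"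
proof -
  have "(\<Sum>k\<in>UNIV. overlap c E L i j k)
      = (\<Sum>l\<le>L. \<Sum>k\<in>UNIV. hop c E l (axis i 1) $ k * hop c E l (axis j 1) $ k)"
    unfolding overlap_def by (rule sum.swap)
  also have "\<dots> \<le> (\<Sum>l\<le>L. \<Sum>k\<in>UNIV. hop c E l (axis i 1) $ k * sqrt c ^ l)"
    using assms by (intro sum_mono mult_left_mono hop_axis_nonneg hop_axis_le) auto
  also have "\<dots> = (\<Sum>l\<le>L. (\<Sum>k\<in>UNIV. hop c E l (axis i 1) $ k) * sqrt c ^ l)"
    by (simp add: sum_distrib_right)
  also have "\<dots> \<le> (\<Sum>l\<le>L. sqrt c ^ l * sqrt c ^ l)"
    using assms by (intro sum_mono mult_right_mono sum_hop_axis_le) auto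
  also have "\<dots> = (\<Sum>l\<le>L. c ^ l)"
    using assms by (simp flip: power_mult_distrib)
  also have "\<dots> \<le> 1 / (1 - c)"
    using assms by (simp add: sum_gp0 divide_right_mono)
  finally show ?thesis .
qed

lemma power_num_iters_le:
  assumes "0 < c" "c < 1" "0 < \<epsilon>" "\<epsilon> < 1"
  shows "c ^ num_iters c \<epsilon> \<le> \<epsilon> / 2"
proof -
  have "log (1 / c) (2 / \<epsilon>) \<le> real (num_iters c \<epsilon>)"
    unfolding num_iters_def by (rule real_nat_ceiling_ge)
  then have "2 / \<epsilon> \<le> (1 / c) powr real (num_iters c \<epsilon>)"
    using assms by (subst (asm) log_le_iff) auto
  also have "\<dots> = (1 / c) ^ num_iters c \<epsilon>"
    using assms by (simp add: powr_realpow)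
  finally show ?thesis
    using assms by (simp add: power_divide field_simps)
qed


subsection \<open>Concentration of weighted empirical frequencies\<close>

lemma nn_integral_exp_indicator_le:
  fixes s :: real
  shows "(\<integral>\<^sup>+x. exp (s * (indicator Q x - measure_pmf.prob p Q)) \<partial>measure_pmf p) \<le> ennreal (exp (s\<^sup>2 / 8))"
proof -
  \<comment> \<open>Absorbing \<open>s\<close> into the variable allows either sign of
    \<open>s\<close>: Hoeffding's lemma is then used with parameter 1 on an interval of length
    \<open>|s|\<close>.\<close>
  interpret interval_bounded_random_variable "measure_pmf p" "\<lambda>x. s * indicator Q x" "min 0 s" "max 0 s"
    by unfold_locales (auto simp: indicator_def)
  have "(max 0 s - min 0 s)\<^sup>2 = s\<^sup>2"
    by (simp add: max_def min_def)
  then show ?thesis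
    using Hoeffdings_lemma_nn_integral[of 1] by (simp add: right_diff_distrib)
qed

text \<open>Splitting off the first sample factorizes the integrand, and each independent sample
  contributes a factor of at most \<open>exp (s\<^sup>2 / 8)\<close>.\<close>

lemma nn_integral_exp_count_le:
  fixes s :: real
  shows "(\<integral>\<^sup>+xs. exp (s * (real (length (filter Q xs)) - real m * measure_pmf.prob p {x. Q x})) \<partial>replicate_pmf m p)
           \<le> ennreal (exp (real m * s\<^sup>2 / 8))"
proof (induction m)
  case (Suc m)
  let ?q = "measure_pmf.prob p {x. Q x}"
  have "(\<integral>\<^sup>+xs. exp (s * (real (length (filter Q xs)) - real (Suc m) * ?q)) \<partial>replicate_pmf (Suc m) p)
     = (\<integral>\<^sup>+x. \<integral>\<^sup>+xs. ennreal (exp (s * (indicator {x. Q x} x - ?q)))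
          * ennreal (exp (s * (real (length (filter Q xs)) - real m * ?q))) \<partial>replicate_pmf m p \<partial>p)"
  proof -
    have "exp (s * (real (length (filter Q (x # xs))) - real (Suc m) * ?q))
        = exp (s * (indicator {x. Q x} x - ?q)) * exp (s * (real (length (filter Q xs)) - real m * ?q))"
      for x xs
      unfolding exp_add[symmetric] by (simp add: algebra_simps indicator_def)
    then show ?thesis by (simp add: ennreal_mult)
  qed
  also have "\<dots> = (\<integral>\<^sup>+x. exp (s * (indicator {x. Q x} x - ?q)) \<partial>p)
          * (\<integral>\<^sup>+xs. exp (s * (real (length (filter Q xs)) - real m * ?q)) \<partial>replicate_pmf m p)"
    by (simp add: nn_integral_cmult nn_integral_multc)
  also have "\<dots> \<le> ennreal (exp (s\<^sup>2 / 8)) * ennreal (exp (real m * s\<^sup>2 / 8))"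
    by (intro mult_mono nn_integral_exp_indicator_le Suc.IH) auto
  also have "\<dots> = ennreal (exp (real (Suc m) * s\<^sup>2 / 8))"
    unfolding ennreal_mult[symmetric, OF exp_ge_zero exp_ge_zero] exp_add[symmetric]
    by (simp add: distrib_right add_divide_distrib)
  finally show ?case .
qed simp

text \<open>Chernoff's method for independent coordinates; \<open>v k\<close> acts as the squared
  range in Hoeffding's bound.\<close>

lemma prob_Pi_pmf_weighted_sum_ge:
  fixes p :: "'k::finite \<Rightarrow> real pmf" and v \<mu> w :: "'k \<Rightarrow> real"
  assumes mgf: "\<And>s k. (\<integral>\<^sup>+x. exp (s * (w k * (x - \<mu> k))) \<partial>p k) \<le> ennreal (exp (s\<^sup>2 * v k / 8))"
    and V: "(\<Sum>k\<in>UNIV. v k) \<le> V" "0 < V" and t: "0 < t"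
  shows "measure_pmf.prob (Pi_pmf UNIV dflt p) {x. t \<le> (\<Sum>k\<in>UNIV. w k * (x k - \<mu> k))} \<le> exp (- 2 * t\<^sup>2 / V)"
proof -
  \<comment> \<open>The value \<open>4 * t / V\<close> minimizes
    \<open>- s * t + s\<^sup>2 * V / 8\<close> over \<open>s\<close>; the minimum is
    \<open>- 2 * t\<^sup>2 / V\<close>.\<close>
  let ?P = "Pi_pmf UNIV dflt p" and ?s = "4 * t / V"
  let ?X = "\<lambda>x. \<Sum>k\<in>UNIV. w k * (x k - \<mu> k)"
  have s: "?s > 0" using V(2) t by simp
  have "(\<integral>\<^sup>+x. exp (?s * ?X x) \<partial>?P)
      = (\<integral>\<^sup>+x. (\<Prod>k\<in>UNIV. ennreal (exp (?s * (w k * (x k - \<mu> k))))) \<partial>?P)"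
    unfolding sum_distrib_left by (simp only: exp_sum[OF finite] prod_ennreal[OF exp_ge_zero])
  also have "\<dots> = (\<Prod>k\<in>UNIV. \<integral>\<^sup>+x. ennreal (exp (?s * (w k * (x - \<mu> k)))) \<partial>p k)"
    by (rule nn_integral_prod_Pi_pmf) simp
  also have "\<dots> \<le> (\<Prod>k\<in>UNIV. ennreal (exp (?s\<^sup>2 * v k / 8)))"
    by (intro prod_mono_ennreal mgf)
  also have "\<dots> = ennreal (exp (?s\<^sup>2 * (\<Sum>k\<in>UNIV. v k) / 8))"
    unfolding sum_distrib_left sum_divide_distrib by (simp only: exp_sum[OF finite] prod_ennreal[OF exp_ge_zero])
  also have "\<dots> \<le> ennreal (exp (?s\<^sup>2 * V / 8))"
    using V(1) by (intro ennreal_leI) (simp add: mult_left_mono divide_right_mono)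
  finally have mgf_sum: "(\<integral>\<^sup>+x. exp (?s * ?X x) \<partial>?P) \<le> ennreal (exp (?s\<^sup>2 * V / 8))" .
  have exponent: "- ?s * t + ?s\<^sup>2 * V / 8 = - 2 * t\<^sup>2 / V"
    using V(2) by (simp add: power2_eq_square field_simps)
  have "emeasure ?P {x. t \<le> ?X x} \<le> ennreal (exp (- ?s * t)) * (\<integral>\<^sup>+x. exp (?s * ?X x) \<partial>?P)"
    using Chernoff_ineq_nn_integral_ge[OF s, of UNIV "measure_pmf ?P" ?X t] by simp
  also have "\<dots> \<le> ennreal (exp (- ?s * t)) * ennreal (exp (?s\<^sup>2 * V / 8))"
    by (intro mult_left_mono mgf_sum) simp
  also have "\<dots> = ennreal (exp (- 2 * t\<^sup>2 / V))"
    unfolding ennreal_mult[symmetric, OF exp_ge_zero exp_ge_zero] exp_add[symmetric] exponent ..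
  finally show ?thesis
    by (simp add: measure_pmf.emeasure_eq_measure)
qed

lemma prob_Pi_pmf_weighted_sum_abs_ge:
  fixes p :: "'k::finite \<Rightarrow> real pmf" and v \<mu> w :: "'k \<Rightarrow> real"
  assumes mgf: "\<And>s k. (\<integral>\<^sup>+x. exp (s * (w k * (x - \<mu> k))) \<partial>p k) \<le> ennreal (exp (s\<^sup>2 * v k / 8))"
    and V: "(\<Sum>k\<in>UNIV. v k) \<le> V" "0 < V" and t: "0 < t"
  shows "measure_pmf.prob (Pi_pmf UNIV dflt p) {x. t \<le> \<bar>\<Sum>k\<in>UNIV. w k * (x k - \<mu> k)\<bar>}
           \<le> 2 * exp (- 2 * t\<^sup>2 / V)"
proof -
  let ?P = "Pi_pmf UNIV dflt p"
  \<comment> \<open>The moment bound holds for every real \<open>s\<close>, hence also for the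
    weights \<open>- w\<close>; this gives the lower tail.\<close>
  have neg: "(\<integral>\<^sup>+x. exp (s * (- w k * (x - \<mu> k))) \<partial>p k) \<le> ennreal (exp (s\<^sup>2 * v k / 8))" for s k
    using mgf[where s = "- s" and k = k] by simp
  have "measure_pmf.prob ?P {x. t \<le> \<bar>\<Sum>k\<in>UNIV. w k * (x k - \<mu> k)\<bar>}
      \<le> measure_pmf.prob ?P ({x. t \<le> (\<Sum>k\<in>UNIV. w k * (x k - \<mu> k))}
                              \<union> {x. t \<le> (\<Sum>k\<in>UNIV. - w k * (x k - \<mu> k))})"
    by (intro measure_pmf.finite_measure_mono) (auto simp: sum_negf abs_real_def)
  also have "\<dots> \<le> measure_pmf.prob ?P {x. t \<le> (\<Sum>k\<in>UNIV. w k * (x k - \<mu> k))}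
      + measure_pmf.prob ?P {x. t \<le> (\<Sum>k\<in>UNIV. - w k * (x k - \<mu> k))}"
    by (intro measure_Un_le) auto
  also have "\<dots> \<le> 2 * exp (- 2 * t\<^sup>2 / V)"
    unfolding mult_2
    by (intro add_mono prob_Pi_pmf_weighted_sum_ge[OF _ V t] mgf neg)
  finally show ?thesis .
qed

text \<open>The weighted average sums \<open>m\<close> independent terms of range
  \<open>|w| / m\<close>, whose squared ranges add up to \<open>w\<^sup>2 / m\<close>. Without
  samples the estimate is constantly 0 and need not be centred at the probability, so the weight
  must vanish.\<close>

lemma nn_integral_exp_diag_estimate_le:
  fixes s w :: real
  assumes "m = 0 \<Longrightarrow> w = 0"
  shows "(\<integral>\<^sup>+x. exp (s * (w * (x - measure_pmf.prob (pair_pmf (sqrtc_walk c E k) (sqrtc_walk c E k))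
                   {(xs, ys). \<not> walks_meet xs ys}))) \<partial>diag_estimate c E m k)
           \<le> ennreal (exp (s\<^sup>2 * (w\<^sup>2 / real m) / 8))"
proof (cases "m = 0")
  case True
  then show ?thesis using assms by simp
next
  case False
  let ?p = "pair_pmf (sqrtc_walk c E k) (sqrtc_walk c E k)"
  let ?Q = "\<lambda>(xs, ys). \<not> walks_meet xs ys"
  let ?q = "measure_pmf.prob ?p {x. ?Q x}"
  have eq: "s * (w * (real n / real m - q)) = s * w / real m * (real n - real m * q)" for n q
    using False by (simp add: divide_simps)
  have "(\<integral>\<^sup>+x. exp (s * (w * (x - ?q))) \<partial>diag_estimate c E m k)
      = (\<integral>\<^sup>+xs. exp (s * w / real m * (real (length (filter ?Q xs)) - real m * ?q)) \<partial>replicate_pmf m ?p)"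
    unfolding diag_estimate_def nn_integral_map_pmf eq ..
  also have "\<dots> \<le> ennreal (exp (real m * (s * w / real m)\<^sup>2 / 8))"
    by (rule nn_integral_exp_count_le)
  also have "real m * (s * w / real m)\<^sup>2 / 8 = s\<^sup>2 * (w\<^sup>2 / real m) / 8"
    using False by (simp add: power2_eq_square)
  finally show ?thesis .
qed

subsection \<open>The error of a single output entry\<close>

lemma prob_not_meet:
  fixes E :: "('n::finite \<times> 'n) set"
  shows "measure_pmf.prob (pair_pmf (sqrtc_walk c E k) (sqrtc_walk c E k))
           {(xs, ys). \<not> walks_meet xs ys} = 1 - meet_prob c E k k"
proof -
  let ?p = "pair_pmf (sqrtc_walk c E k) (sqrtc_walk c E k)"
  let ?A = "{(xs :: 'n list, ys). walks_meet xs ys}"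
  have "meet_prob c E k k = pmf (map_pmf (\<lambda>(xs, ys). walks_meet xs ys) ?p) True"
    by (simp add: meet_prob_def pair_pmf_def map_bind_pmf)
  also have "\<dots> = measure_pmf.prob ?p ?A"
    by (simp add: pmf_map vimage_def case_prod_unfold)
  finally have "1 - meet_prob c E k k = measure_pmf.prob ?p (UNIV - ?A)"
    using measure_pmf.prob_compl[of ?A ?p] by simp
  also have "UNIV - ?A = {(xs, ys). \<not> walks_meet xs ys}"
    by auto
  finally show ?thesis ..
qed

lemma simrank_sub_weighted_sum:
  fixes E :: "('n::finite \<times> 'n) set"
  assumes c: "0 < c" "c < 1"
  shows "simrank c E $ i $ j - (\<Sum>k\<in>UNIV. (1 - meet_prob c E k k) * overlap c E L i j k)
           \<in> {0..c ^ Suc L}"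
proof (rule simrank_decomp)
  show "is_simrank c E (simrank c E)"
    unfolding simrank_def by (rule theI'[OF ex1_is_simrank[OF c]])
  show "1 - meet_prob c E k k = 1 - (\<Sum>a\<in>in_nbrs E k. \<Sum>b\<in>in_nbrs E k.
          c * simrank c E $ a $ b / (real (in_deg E k) * real (in_deg E k)))" for k
    by (subst meet_prob_eq[OF c]) (simp add: simrank_eq_meet_prob[OF c])
  show "simrank c E $ a $ b \<in> {0..1}" for a b
    by (simp add: simrank_eq_meet_prob[OF c] meet_prob_def pmf_le_1)
qed (use c in auto)

lemma prob_exactsim_error:
  fixes E :: "('n::finite \<times> 'n) set"
  assumes c: "0 < c" "c < 1" and \<epsilon>: "0 < \<epsilon>" "\<epsilon> < 1" and n: "1 < CARD('n)"
  shows "measure_pmf.prob (exactsim c E \<epsilon> i) {x. \<not> \<bar>x $ j - simrank c E $ i $ j\<bar> \<le> \<epsilon>}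
           \<le> 2 * exp (- 12 * ln (real CARD('n)))"
proof -
  define L where "L = num_iters c \<epsilon>"
  define R where "R = 6 * ln (real CARD('n)) / ((1 - sqrt c) ^ 4 * \<epsilon>\<^sup>2)"
  define r where "r = num_samples c E \<epsilon> i"
  define w where "w = overlap c E L i j"
  define q where "q = (\<lambda>k. 1 - meet_prob c E k k)"
  define t where "t = (1 - sqrt c) * \<epsilon>"
  \<comment> \<open>This bounds the sum of \<open>(w k)\<^sup>2 / r k\<close>: the sample count
    absorbs one factor \<open>w k\<close> at cost \<open>1 / (R * (1 - sqrt c))\<close>, and the
    remaining weights sum to at most \<open>1 / (1 - c) \<le> 1 / (1 - sqrt c)\<close>.\<close>
  define V where "V = 1 / (R * (1 - sqrt c)\<^sup>2)"
  let ?P = "Pi_pmf UNIV 0 (\<lambda>k. diag_estimate c E (r k) k)"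
  have x: "0 < sqrt c" "sqrt c < 1" using c by auto
  \<comment> \<open>A single node would give \<open>R = 0\<close>, since
    \<open>ln 1 = 0\<close>.\<close>
  have R: "0 < R" using n x \<epsilon> by (simp add: R_def)
  have V: "0 < V" using R x by (simp add: V_def)
  have t: "0 < t" using x \<epsilon> by (simp add: t_def)
  have w0: "0 \<le> w k" for k
    using c by (simp add: w_def overlap_nonneg)
  have wr: "w k \<le> real (r k) / (R * (1 - sqrt c))" for k
  proof -
    have "R * ppr c E \<epsilon> i $ k \<le> real (r k)"
      unfolding r_def num_samples_def R_def by (rule real_nat_ceiling_ge)
    then have "ppr c E \<epsilon> i $ k \<le> real (r k) / R"
      using R by (simp add: field_simps)
    then have "ppr c E \<epsilon> i $ k / (1 - sqrt c) \<le> real (r k) / (R * (1 - sqrt c))"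
      using x by (simp add: divide_right_mono flip: divide_divide_eq_left)
    moreover have "w k \<le> ppr c E \<epsilon> i $ k / (1 - sqrt c)"
      unfolding w_def L_def using c by (intro overlap_le_ppr) auto
    ultimately show ?thesis by (rule order_trans[rotated])
  qed
  have mgf: "(\<integral>\<^sup>+x. exp (s * (w k * (x - q k))) \<partial>diag_estimate c E (r k) k)
      \<le> ennreal (exp (s\<^sup>2 * ((w k)\<^sup>2 / real (r k)) / 8))" for s k
    unfolding q_def prob_not_meet[symmetric]
  proof (rule nn_integral_exp_diag_estimate_le)
    \<comment> \<open>A node without samples carries no weight: \<open>wr\<close> and
      \<open>w0\<close> squeeze \<open>w k\<close> to 0.\<close>
    show "w k = 0" if "r k = 0" using wr[of k] w0[of k] that by simp
  qed
  have "(\<Sum>k\<in>UNIV. (w k)\<^sup>2 / real (r k)) \<le> (\<Sum>k\<in>UNIV. w k / (R * (1 - sqrt c)))"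
  proof (rule sum_mono)
    fix k
    show "(w k)\<^sup>2 / real (r k) \<le> w k / (R * (1 - sqrt c))"
    proof (cases "r k = 0")
      case False
      then have "w k / real (r k) \<le> 1 / (R * (1 - sqrt c))"
        using wr[of k] R x by (simp add: field_simps)
      from mult_left_mono[OF this w0[of k]] show ?thesis
        by (simp add: power2_eq_square)
    qed (use w0[of k] R x in simp)
  qed
  also have "\<dots> = (\<Sum>k\<in>UNIV. w k) / (R * (1 - sqrt c))"
    by (simp add: sum_divide_distrib)
  also have "\<dots> \<le> (1 / (1 - sqrt c)) / (R * (1 - sqrt c))"
  proof (intro divide_right_mono)
    have "(\<Sum>k\<in>UNIV. w k) \<le> 1 / (1 - c)"
      unfolding w_def using c by (intro sum_overlap_le) auto
    also have "c \<le> sqrt c"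
      using c by (simp add: real_le_rsqrt power2_eq_square mult_left_le)
    then have "1 / (1 - c) \<le> 1 / (1 - sqrt c)"
      using x c by (intro divide_left_mono) auto
    finally show "(\<Sum>k\<in>UNIV. w k) \<le> 1 / (1 - sqrt c)" .
  qed (use R x in auto)
  also have "\<dots> = V"
    by (simp add: V_def power2_eq_square)
  finally have sum_v: "(\<Sum>k\<in>UNIV. (w k)\<^sup>2 / real (r k)) \<le> V" .
  have "measure_pmf.prob (exactsim c E \<epsilon> i) {x. \<not> \<bar>x $ j - simrank c E $ i $ j\<bar> \<le> \<epsilon>}
      = measure_pmf.prob ?P {d. \<not> \<bar>(\<Sum>k\<in>UNIV. d k * w k) - simrank c E $ i $ j\<bar> \<le> \<epsilon>}"
    unfolding exactsim_def D_hat_def diag_mat_def[symmetric] pmf.map_comp measure_map_pmf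
      vimage_Collect_eq o_def exactsim_iter_diag_mat[OF c(2)] w_def L_def r_def ..
  also have "\<dots> \<le> measure_pmf.prob ?P {d. t \<le> \<bar>\<Sum>k\<in>UNIV. w k * (d k - q k)\<bar>}"
  proof (rule measure_pmf.finite_measure_mono)
    have "c ^ Suc L \<le> c * (\<epsilon> / 2)"
      using power_num_iters_le[OF c \<epsilon>] c by (simp add: L_def)
    \<comment> \<open>After division by \<open>\<epsilon>\<close> this amounts to
      \<open>c / 2 \<le> sqrt c\<close>.\<close>
    moreover have "t \<le> \<epsilon> - c * (\<epsilon> / 2)"
    proof -
      have "c = sqrt c * sqrt c" using c by simp
      also have "\<dots> \<le> sqrt c * 2" using x by (intro mult_left_mono) linarith+
      finally have "\<epsilon> * (c / 2) \<le> \<epsilon> * sqrt c" using \<epsilon> by (intro mult_left_mono) auto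
      then show ?thesis by (simp add: t_def algebra_simps)
    qed
    moreover have "simrank c E $ i $ j - (\<Sum>k\<in>UNIV. q k * w k) \<in> {0..c ^ Suc L}"
      unfolding q_def w_def by (rule simrank_sub_weighted_sum[OF c])
    moreover have "(\<Sum>k\<in>UNIV. w k * (d k - q k)) = (\<Sum>k\<in>UNIV. d k * w k) - (\<Sum>k\<in>UNIV. q k * w k)" for d
      by (simp add: right_diff_distrib sum_subtractf mult.commute)
    ultimately show "{d. \<not> \<bar>(\<Sum>k\<in>UNIV. d k * w k) - simrank c E $ i $ j\<bar> \<le> \<epsilon>}
        \<subseteq> {d. t \<le> \<bar>\<Sum>k\<in>UNIV. w k * (d k - q k)\<bar>}"
      by auto
  qed auto
  also have "\<dots> \<le> 2 * exp (- 2 * t\<^sup>2 / V)"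
    by (rule prob_Pi_pmf_weighted_sum_abs_ge[OF mgf sum_v V t])
  \<comment> \<open>Here \<open>t\<^sup>2 / V = (1 - sqrt c) ^ 4 * \<epsilon>\<^sup>2 * R\<close>,
    and the choice of \<open>R\<close> makes this \<open>6 * ln (real CARD('n))\<close>.\<close>
  also have "- 2 * t\<^sup>2 / V = - 12 * ln (real CARD('n))"
    using x \<epsilon> by (simp add: t_def V_def R_def power_mult_distrib) (simp add: power2_eq_square power4_eq_xxxx)
  finally show ?thesis .
qed

text \<open>The runs for different sources live on one space \<open>M\<close> under an arbitrary
  joint law, with only the law of each \<open>s i\<close> prescribed; so the quantifier over sources
  can stand inside the probability.\<close>

theorem theorem1:
  fixes E :: "('n::finite \<times> 'n) set"
    and c \<epsilon> :: real
    and M :: "'a measure"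
    and s :: "'n \<Rightarrow> 'a \<Rightarrow> real ^ 'n"
  assumes "0 < c" "c < 1"
    and "0 < \<epsilon>" "\<epsilon> < 1"
    and "prob_space M"
    and "\<And>i. s i \<in> borel_measurable M"
    and "\<And>i. distr M borel (s i) = distr (measure_pmf (exactsim c E \<epsilon> i)) borel (\<lambda>x. x)"
  shows "measure M {\<omega> \<in> space M. \<forall>i j. \<bar>s i \<omega> $ j - simrank c E $ i $ j\<bar> \<le> \<epsilon>}
           \<ge> 1 - 1 / real CARD('n)"
proof (cases "CARD('n) = 1")
  \<comment> \<open>For a single node the claimed lower bound is 0.\<close>
  case True
  then show ?thesis by simp
next
  case False
  interpret prob_space M by fact
  note [measurable] = assms(6)
  define n where "n = real CARD('n)"
  have "0 < CARD('n)" by (rule zero_less_card_finite)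
  with False have card: "1 < CARD('n)" by linarith
  then have n: "2 \<le> n" by (simp add: n_def)
  define B where "B = (\<lambda>(i, j). {\<omega> \<in> space M. \<not> \<bar>s i \<omega> $ j - simrank c E $ i $ j\<bar> \<le> \<epsilon>})"
  have B_sets: "B ij \<in> sets M" for ij
    unfolding B_def by (cases ij) simp
  have B_prob: "prob (B ij) \<le> 2 / n ^ 12" for ij
  proof (cases ij)
    case (Pair i j)
    let ?X = "{x :: real ^ 'n. \<not> \<bar>x $ j - simrank c E $ i $ j\<bar> \<le> \<epsilon>}"
    have X: "?X \<in> sets borel" by measurable
    have "prob (B ij) = measure (distr M borel (s i)) ?X"
      unfolding measure_distr[OF assms(6) X] B_def Pair by (auto intro!: arg_cong[of _ _ prob])
    also have "\<dots> = measure_pmf.prob (exactsim c E \<epsilon> i) ?X"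
      unfolding assms(7) by (subst measure_distr) (use X in auto)
    also have "\<dots> \<le> 2 * exp (- 12 * ln n)"
      unfolding n_def by (rule prob_exactsim_error[OF assms(1-4) card])
    also have "exp (- 12 * ln n) = 1 / n ^ 12"
      using n exp_of_nat_mult[of 12 "ln n"] by (simp add: exp_minus inverse_eq_divide)
    finally show ?thesis by simp
  qed
  have "prob (\<Union>ij. B ij) \<le> (\<Sum>ij\<in>UNIV. prob (B ij))"
    by (intro finite_measure_subadditive_finite) (use B_sets in auto)
  also have "\<dots> \<le> (\<Sum>ij\<in>(UNIV :: ('n \<times> 'n) set). 2 / n ^ 12)"
    by (intro sum_mono B_prob)
  also have "\<dots> = n * n * 2 / n ^ 12"
    by (simp add: n_def)
  also have "\<dots> \<le> 1 / n"
  proof -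
    \<comment> \<open>From \<open>2 \<le> n\<close> and \<open>n \<le> n ^ 9\<close>.\<close>
    have "2 * n ^ 3 \<le> n ^ 9 * n ^ 3"
      using n self_le_power[of n 9] by (intro mult_right_mono) auto
    then have "n * n * 2 * n \<le> 1 * n ^ 12"
      by (simp add: power_add[symmetric]) (simp add: power3_eq_cube mult_ac)
    then show ?thesis
      using n by (subst frac_le_eq) (simp_all add: divide_le_0_iff)
  qed
  finally have "prob (\<Union>ij. B ij) \<le> 1 / n" .
  moreover have "{\<omega> \<in> space M. \<forall>i j. \<bar>s i \<omega> $ j - simrank c E $ i $ j\<bar> \<le> \<epsilon>}
      = space M - (\<Union>ij. B ij)"
    by (auto simp: B_def)
  moreover have "prob (space M - (\<Union>ij. B ij)) = 1 - prob (\<Union>ij. B ij)"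
    by (intro prob_compl sets.finite_UN) (use B_sets in auto)
  ultimately show ?thesis by (simp add: n_def)
qed

end
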